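(* Let $C$ be a cycle and let $\mathcal H,\mathcal K$ be families of vertex subsets of $C$ such that $(C,\mathcal H,\mathcal K)$ is strong $axax$-free. Then there is an outerplanar graph $Q$ with vertex set $\mathcal H$ such that for every $K\in\mathcal K$ the set $\mathcal H_K=\{H\in\mathcal H: H\cap K\ne\emptyset\}$ induces a connected subgraph of $Q$.
   Context: Let $C$ be a cycle with a fixed cyclic orientation; "vertices $p_1,p_2,p_3,p_4$ in cyclic order" means they are four distinct vertices met in this order when traversing $C$. Members of $\mathcal H,\mathcal K$ are arbitrary subsets of $V(C)$ (not necessarily inducing connected subgraphs of $C$). A pair $H,H'\in\mathcal H$ is an $axax$-pair if there are vertices $a_1,x_1,a_2,x_2$ in cyclic order with $a_1,a_2\in H\setminus H'$ and $x_1,x_2\in H'$; $(C,\mathcal H)$ is $axax$-free if it has no $axax$-pair. $(C,\mathcal H,\mathcal K)$ satisfies the intersection property if for all $H\in\mathcal H$, $K\in\mathcal K$ having vertices $h_1,k_1,h_2,k_2$ in cyclic order with $h_1,h_2\in H$, $k_1,k_2\in K$, we have $H\cap K\ne\emptyset$. $(C,\mathcal H,\mathcal K)$ is strong $axax$-free if $(C,\mathcal H)$ and $(C,\mathcal K)$ are both $axax$-free and the intersection property holds. A graph is outerplanar if it has a plane embedding with all vertices on the outer face. *)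

theory Defs
  imports "HOL-Analysis.Analysis"
begin

text \<open>The cycle C is modelled (up to isomorphism) as the cycle on the vertex set {0..<n},
  n \<ge> 3, with edges i -- (i+1) mod n and cyclic orientation given by increasing index.\<close>

definition cyc_order :: "nat \<Rightarrow> nat \<Rightarrow> nat \<Rightarrow> nat \<Rightarrow> nat \<Rightarrow> bool" where
  "cyc_order n a b c d \<longleftrightarrow> a < n \<and> b < n \<and> c < n \<and> d < n \<and>
     (a < b \<and> b < c \<and> c < d \<or> b < c \<and> c < d \<and> d < a \<or>
      c < d \<and> d < a \<and> a < b \<or> d < a \<and> a < b \<and> b < c)"

definition axax_pair :: "nat \<Rightarrow> nat set \<Rightarrow> nat set \<Rightarrow> bool" where
  "axax_pair n H H' \<longleftrightarrow> (\<exists>a1 x1 a2 x2. cyc_order n a1 x1 a2 x2 \<and>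
     a1 \<in> H - H' \<and> a2 \<in> H - H' \<and> x1 \<in> H' \<and> x2 \<in> H')"

definition axax_free :: "nat \<Rightarrow> nat set set \<Rightarrow> bool" where
  "axax_free n \<H> \<longleftrightarrow> (\<forall>H\<in>\<H>. \<forall>H'\<in>\<H>. \<not> axax_pair n H H')"

definition intersection_property :: "nat \<Rightarrow> nat set set \<Rightarrow> nat set set \<Rightarrow> bool" where
  "intersection_property n \<H> \<K> \<longleftrightarrow> (\<forall>H\<in>\<H>. \<forall>K\<in>\<K>.
     (\<exists>h1 k1 h2 k2. cyc_order n h1 k1 h2 k2 \<and> h1 \<in> H \<and> h2 \<in> H \<and> k1 \<in> K \<and> k2 \<in> K)
     \<longrightarrow> H \<inter> K \<noteq> {})"

definition strong_axax_free :: "nat \<Rightarrow> nat set set \<Rightarrow> nat set set \<Rightarrow> bool" where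
  "strong_axax_free n \<H> \<K> \<longleftrightarrow>
     axax_free n \<H> \<and> axax_free n \<K> \<and> intersection_property n \<H> \<K>"

definition simple_graph :: "'v set \<Rightarrow> ('v \<Rightarrow> 'v \<Rightarrow> bool) \<Rightarrow> bool" where
  "simple_graph V E \<longleftrightarrow> (\<forall>u v. E u v \<longrightarrow> u \<in> V \<and> v \<in> V \<and> u \<noteq> v \<and> E v u)"

definition induces_connected :: "('v \<Rightarrow> 'v \<Rightarrow> bool) \<Rightarrow> 'v set \<Rightarrow> bool" where
  "induces_connected E S \<longleftrightarrow>
     (\<forall>x\<in>S. \<forall>y\<in>S. (\<lambda>u v. E u v \<and> u \<in> S \<and> v \<in> S)\<^sup>*\<^sup>* x y)"

definition drawing :: "'v set \<Rightarrow> ('v \<Rightarrow> 'v \<Rightarrow> bool) \<Rightarrow> ('v \<Rightarrow> complex)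
    \<Rightarrow> ('v \<Rightarrow> 'v \<Rightarrow> real \<Rightarrow> complex) \<Rightarrow> complex set" where
  "drawing V E p \<gamma> = p ` V \<union> \<Union>{path_image (\<gamma> u v) | u v. E u v}"

definition outerplanar :: "'v set \<Rightarrow> ('v \<Rightarrow> 'v \<Rightarrow> bool) \<Rightarrow> bool" where
  "outerplanar V E \<longleftrightarrow> (\<exists>(p :: 'v \<Rightarrow> complex) (\<gamma> :: 'v \<Rightarrow> 'v \<Rightarrow> real \<Rightarrow> complex).
     inj_on p V \<and>
     (\<forall>u v. E u v \<longrightarrow> arc (\<gamma> u v) \<and> pathstart (\<gamma> u v) = p u \<and> pathfinish (\<gamma> u v) = p v
        \<and> path_image (\<gamma> v u) = path_image (\<gamma> u v)
        \<and> path_image (\<gamma> u v) \<inter> p ` V = {p u, p v}) \<and>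
     (\<forall>u v x y. E u v \<and> E x y \<and> {u, v} \<noteq> {x, y} \<longrightarrow>
        path_image (\<gamma> u v) \<inter> path_image (\<gamma> x y) \<subseteq> p ` ({u, v} \<inter> {x, y})) \<and>
     (\<forall>v\<in>V. p v \<in> closure (outside (drawing V E p \<gamma>))))"

end

theory Submission
  imports Defs "HOL-Library.Nat_Bijection"
begin

text \<open>Order the members of \<open>\<H>\<close> by their minimum, and those with equal minimum so that the one
  containing the largest element of the symmetric difference comes first. Writing \<open>\<H>\<^sub>K\<close> for the
  members hitting \<open>K\<close>, strong axax-freeness forbids \<open>H\<^sub>1 < H\<^sub>2 < H\<^sub>3 < H\<^sub>4\<close> with
  \<open>H\<^sub>1, H\<^sub>3 \<in> \<H>\<^sub>K - \<H>\<^sub>L\<close>, \<open>H\<^sub>2 \<in> \<H>\<^sub>L - \<H>\<^sub>K\<close> and \<open>H\<^sub>4 \<in> \<H>\<^sub>L\<close>. Any hypergraph on a finite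
  linear order without this pattern has a connected support with pairwise non-crossing edges: among
  all pairs \<open>u < v\<close> that are consecutive in some hyperedge but not on the closed polygon through the
  vertices, take one with least \<open>v\<close>. Every hyperedge with vertices on both sides of the chord \<open>uv\<close>
  contains \<open>u\<close> or \<open>v\<close>, so supports of the two sides can be glued. Drawing the edges as chords of a
  parabola makes the support outerplanar.\<close>

section \<open>Chords of a parabola\<close>

text \<open>The graph of a strictly convex function: points on it are in convex position in the
  order of their parameters, and the region below it stays free of chords.\<close>

definition parabola :: "real \<Rightarrow> complex" where
  "parabola t = Complex t (t\<^sup>2)"

lemma parabola_eq_iff [simp]: "parabola s = parabola t \<longleftrightarrow> s = t"
  by (auto simp: parabola_def)

text \<open>The height above the parabola factors as \<open>(Re z - s) * (t - Re z)\<close>, so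
  statements about chords become comparisons of quadratics in \<open>Re z\<close>.\<close>

lemma parabola_chord:
  assumes "z \<in> closed_segment (parabola s) (parabola t)"
  shows "Im z - (Re z)\<^sup>2 = (Re z - s) * (t - Re z)" "min s t \<le> Re z" "Re z \<le> max s t"
proof -
  obtain u where u: "0 \<le> u" "u \<le> 1" and z: "z = (1 - u) *\<^sub>R parabola s + u *\<^sub>R parabola t"
    using assms by (auto simp: in_segment)
  have re: "Re z = (1 - u) * s + u * t" and im: "Im z = (1 - u) * s\<^sup>2 + u * t\<^sup>2"
    by (simp_all add: z parabola_def)
  show "Im z - (Re z)\<^sup>2 = (Re z - s) * (t - Re z)"
    unfolding re im by (simp add: algebra_simps power2_eq_square)
  have "Re z \<in> closed_segment s t"
    using u by (auto simp: in_segment re)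
  then show "min s t \<le> Re z" "Re z \<le> max s t"
    by (auto simp: closed_segment_eq_real_ivl split: if_splits)
qed

lemma parabola_chord_above:
  assumes "z \<in> closed_segment (parabola s) (parabola t)"
  shows "(Re z)\<^sup>2 \<le> Im z"
proof -
  have "0 \<le> (Re z - s) * (t - Re z)"
    using parabola_chord(2,3)[OF assms]
    by (auto simp: zero_le_mult_iff min_def max_def split: if_splits)
  then show ?thesis
    using parabola_chord(1)[OF assms] by simp
qed

lemma parabola_chord_end:
  assumes "z \<in> closed_segment (parabola s) (parabola t)" "Re z = s \<or> Re z = t"
  shows "z = parabola (Re z)"
  using parabola_chord(1)[OF assms(1)] assms(2) by (auto simp: parabola_def complex_eq_iff)

text \<open>Non-crossing intervals with a common interior point are nested, and if they are distinct
  the outer chord is strictly higher inside the inner interval. Hence chords can meet only at a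
  shared end.\<close>

lemma parabola_chords_noncrossing:
  fixes s t a b :: real
  assumes z: "z \<in> closed_segment (parabola s) (parabola t)"
      "z \<in> closed_segment (parabola a) (parabola b)"
    and "s < t" "a < b" "\<not> (s < a \<and> a < t \<and> t < b)" "\<not> (a < s \<and> s < b \<and> b < t)"
    and "(s, t) \<noteq> (a, b)"
  shows "\<exists>r \<in> {s, t} \<inter> {a, b}. z = parabola r"
proof -
  define x where "x = Re z"
  have eq: "(x - s) * (t - x) = (x - a) * (b - x)"
    using parabola_chord(1)[OF z(1)] parabola_chord(1)[OF z(2)] by (simp add: x_def)
  have bd: "s \<le> x" "x \<le> t" "a \<le> x" "x \<le> b"
    using parabola_chord(2,3)[OF z(1)] parabola_chord(2,3)[OF z(2)] assms(3,4)
    by (auto simp: x_def)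
  have strict: "(x - p) * (q - x) < (x - c) * (d - x)"
    if "c \<le> p" "q \<le> d" "(p, q) \<noteq> (c, d)" "p < x" "x < q" for p q c d
  proof (cases "c < p")
    case True
    have "(x - p) * (q - x) < (x - c) * (q - x)"
      using True that by (intro mult_strict_right_mono) auto
    also have "\<dots> \<le> (x - c) * (d - x)"
      using that by (intro mult_left_mono) auto
    finally show ?thesis .
  next
    case False
    then show ?thesis
      using that by (auto intro!: mult_strict_left_mono)
  qed
  have "x = s \<or> x = t \<or> x = a \<or> x = b"
  proof (rule ccontr)
    assume "\<not> ?thesis"
    then have int: "s < x" "x < t" "a < x" "x < b"
      using bd by auto
    then have "s \<le> a \<and> b \<le> t \<or> a \<le> s \<and> t \<le> b"
      using assms(5,6) by linarith
    then show False
      using strict[of s a b t] strict[of a s t b] int eq assms(7) by auto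
  qed
  \<comment> \<open>\<open>x\<close> is an end of one chord, where the product of that chord is
    zero; by \<open>eq\<close> the other product is zero too.\<close>
  then have "(x - s) * (t - x) = 0"
    using eq by auto
  then have "(x = s \<or> x = t) \<and> (x = a \<or> x = b)"
    using eq by auto
  then have "x \<in> {s, t} \<inter> {a, b}"
    by blast
  moreover have "z = parabola x"
    using parabola_chord_end[OF z(1)] calculation by (auto simp: x_def)
  ultimately show ?thesis
    by blast
qed

lemma outerplanar_if_noncrossing:
  fixes f :: "'v \<Rightarrow> real"
  assumes graph: "simple_graph V E" and inj: "inj_on f V"
    and noncrossing: "\<And>u v x y. E u v \<Longrightarrow> E x y \<Longrightarrow> \<not> (f u < f x \<and> f x < f v \<and> f v < f y)"
  shows "outerplanar V E"
proof -
  define p where "p v = parabola (f v)" for v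
  define \<gamma> where "\<gamma> u v = linepath (p u) (p v)" for u v
  have E: "u \<in> V" "v \<in> V" "u \<noteq> v" "E v u" if "E u v" for u v
    using graph that unfolding simple_graph_def by blast+
  have f_eq: "f u = f v \<longleftrightarrow> u = v" if "u \<in> V" "v \<in> V" for u v
    using inj that by (auto dest: inj_onD)
  have p_eq: "p u = p v \<longleftrightarrow> u = v" if "u \<in> V" "v \<in> V" for u v
    using f_eq[OF that] by (simp add: p_def)
  have img: "path_image (\<gamma> u v) = closed_segment (p u) (p v)" for u v
    by (simp add: \<gamma>_def)
  have on_vertices: "path_image (\<gamma> u v) \<inter> p ` V = {p u, p v}" if uv: "E u v" for u v
  proof (intro equalityI subsetI)
    fix z assume "z \<in> path_image (\<gamma> u v) \<inter> p ` V"
    then obtain w where w: "w \<in> V" "z = p w" "z \<in> closed_segment (p u) (p v)"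
      by (auto simp: img)
    \<comment> \<open>A point of the parabola has height zero above it, which forces it to an end of
      the chord.\<close>
    have "(f w - f u) * (f v - f w) = 0"
      using parabola_chord(1)[of z "f u" "f v"] w by (simp add: p_def parabola_def)
    then show "z \<in> {p u, p v}"
      using w by (auto simp: p_def)
  qed (use E[OF uv] in \<open>auto simp: img\<close>)
  have meet_ordered: "path_image (\<gamma> u v) \<inter> path_image (\<gamma> x y) \<subseteq> p ` ({u, v} \<inter> {x, y})"
    if uv: "E u v" and xy: "E x y" and ne: "{u, v} \<noteq> {x, y}" and less: "f u < f v" "f x < f y" for u v x y
  proof
    fix z assume "z \<in> path_image (\<gamma> u v) \<inter> path_image (\<gamma> x y)"
    then have "z \<in> closed_segment (parabola (f u)) (parabola (f v))"
      "z \<in> closed_segment (parabola (f x)) (parabola (f y))"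
      by (auto simp: img p_def)
    moreover have "(f u, f v) \<noteq> (f x, f y)"
      using ne f_eq E[OF uv] E[OF xy] by auto
    ultimately have "\<exists>r \<in> {f u, f v} \<inter> {f x, f y}. z = parabola r"
      using parabola_chords_noncrossing[of z "f u" "f v" "f x" "f y"]
        noncrossing[OF uv xy] noncrossing[OF xy uv] less by blast
    then obtain r where r: "r \<in> {f u, f v} \<inter> {f x, f y}" "z = parabola r"
      by blast
    then obtain w where "w \<in> {u, v} \<inter> {x, y}" "r = f w"
      using f_eq E[OF uv] E[OF xy] by auto
    then show "z \<in> p ` ({u, v} \<inter> {x, y})"
      using r by (auto simp: p_def)
  qed
  have sym: "path_image (\<gamma> v u) = path_image (\<gamma> u v)" for u v
    by (simp add: img closed_segment_commute)
  have meet: "path_image (\<gamma> u v) \<inter> path_image (\<gamma> x y) \<subseteq> p ` ({u, v} \<inter> {x, y})"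
    if uv: "E u v" and xy: "E x y" and ne: "{u, v} \<noteq> {x, y}" for u v x y
  proof -
    \<comment> \<open>Every edge can be read from left to right without changing its segment, so
      \<open>meet_ordered\<close> applies.\<close>
    have "\<exists>u' v'. E u' v' \<and> f u' < f v' \<and> {u', v'} = {u, v} \<and>
        path_image (\<gamma> u' v') = path_image (\<gamma> u v)" if "E u v" for u v
    proof (cases "f u < f v")
      case False
      then have "f v < f u"
        using E[OF that] f_eq[of u v] by simp
      then show ?thesis
        using E(4)[OF that] sym by blast
    qed (use that in blast)
    from this[OF uv] this[OF xy] show ?thesis
      using meet_ordered ne by metis
  qed
  define D where "D = drawing V E p \<gamma>"
  have above: "(Re z)\<^sup>2 \<le> Im z" if "z \<in> D" for z
    using that parabola_chord_above
    by (fastforce simp: D_def drawing_def img p_def parabola_def)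
  have outer: "p v \<in> closure (outside D)" for v
  proof -
    \<comment> \<open>The drawing lies on or above the parabola, so the open vertical ray below a
      vertex is a connected unbounded set missing the drawing; the vertex is in its closure.\<close>
    define ray where "ray = {z. Re z = f v \<and> Im z < (f v)\<^sup>2}"
    have "ray \<subseteq> - D"
      using above by (fastforce simp: ray_def)
    moreover have "connected ray"
    proof (rule convex_connected)
      have "ray = {z. Re z \<le> f v} \<inter> {z. f v \<le> Re z} \<inter> {z. Im z < (f v)\<^sup>2}"
        by (auto simp: ray_def)
      then show "convex ray"
        using convex_halfspace_Re_le[of "f v"] convex_halfspace_Re_ge[of "f v"]
          convex_halfspace_Im_lt[of "(f v)\<^sup>2"] by (simp add: convex_Int)
    qed
    moreover have "\<not> bounded ray"
    proof
      assume "bounded ray"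
      then obtain B where B: "\<And>z. z \<in> ray \<Longrightarrow> norm z \<le> B"
        by (auto simp: bounded_iff)
      let ?z = "Complex (f v) (- \<bar>B\<bar> - 1)"
      have "?z \<in> ray"
        by (simp add: ray_def) (smt (verit) zero_le_power2)
      then show False
        using B[of ?z] abs_Im_le_cmod[of ?z] by simp
    qed
    ultimately have ray_out: "ray \<subseteq> outside D"
      unfolding outside_def
      using connected_component_maximal[of _ ray "- D"] bounded_subset[of _ ray] by blast
    show ?thesis
    proof (rule closure_approachable[THEN iffD2], intro allI impI)
      fix e :: real assume "0 < e"
      then have "Complex (f v) ((f v)\<^sup>2 - e / 2) \<in> ray"
        by (simp add: ray_def)
      moreover have "dist (Complex (f v) ((f v)\<^sup>2 - e / 2)) (p v) < e"
        using \<open>0 < e\<close> by (simp add: p_def parabola_def dist_norm cmod_def)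
      ultimately show "\<exists>y\<in>outside D. dist y (p v) < e"
        using ray_out by blast
    qed
  qed
  have "inj_on p V"
    by (auto simp: inj_on_def p_eq)
  moreover have "arc (\<gamma> u v)" if "E u v" for u v
    using E[OF that] p_eq by (auto simp: \<gamma>_def)
  moreover have "pathstart (\<gamma> u v) = p u" "pathfinish (\<gamma> u v) = p v" for u v
    by (simp_all add: \<gamma>_def)
  ultimately show ?thesis
    unfolding outerplanar_def using sym on_vertices meet outer
    by (intro exI[of _ p] exI[of _ \<gamma>]) (simp add: D_def)
qed

section \<open>Non-crossing supports\<close>

text \<open>For symmetric \<open>E\<close> this one pattern covers every crossing, since the ends of
  an edge and the two edges may be exchanged.\<close>

definition noncrossing :: "('a::linorder \<Rightarrow> 'a \<Rightarrow> bool) \<Rightarrow> bool" where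
  "noncrossing E \<longleftrightarrow> (\<forall>u v x y. E u v \<and> E x y \<longrightarrow> \<not> (u < x \<and> x < v \<and> v < y))"

lemma induces_connected_Un:
  assumes "induces_connected E S" "induces_connected F T" "c \<in> S" "c \<in> T"
  shows "induces_connected (\<lambda>u v. E u v \<or> F u v) (S \<union> T)"
proof -
  let ?R = "\<lambda>u v. (E u v \<or> F u v) \<and> u \<in> S \<union> T \<and> v \<in> S \<union> T"
  have S: "?R\<^sup>*\<^sup>* x y" if "x \<in> S" "y \<in> S" for x y
    using assms(1) that mono_rtranclp[of "\<lambda>u v. E u v \<and> u \<in> S \<and> v \<in> S" ?R]
    by (auto simp: induces_connected_def)
  have T: "?R\<^sup>*\<^sup>* x y" if "x \<in> T" "y \<in> T" for x y
    using assms(2) that mono_rtranclp[of "\<lambda>u v. F u v \<and> u \<in> T \<and> v \<in> T" ?R]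
    by (auto simp: induces_connected_def)
  have "?R\<^sup>*\<^sup>* x c" "?R\<^sup>*\<^sup>* c x" if "x \<in> S \<union> T" for x
    using S T assms(3,4) that by auto
  then show ?thesis
    unfolding induces_connected_def by (meson rtranclp_trans)
qed

lemma induces_connected_mono:
  assumes "induces_connected E S" "\<And>u v. E u v \<Longrightarrow> F u v"
  shows "induces_connected F S"
  using assms mono_rtranclp[of "\<lambda>u v. E u v \<and> u \<in> S \<and> v \<in> S" "\<lambda>u v. F u v \<and> u \<in> S \<and> v \<in> S"]
  by (auto simp: induces_connected_def)

text \<open>A chord between neighbours within \<open>A\<close> that is a proper diagonal of the
  polygon on \<open>V\<close>. The last two conditions make both sides of the chord smaller than
  \<open>V\<close>, so that induction applies to each.\<close>

definition gap_pair :: "'a::linorder set \<Rightarrow> 'a set \<Rightarrow> 'a \<Rightarrow> 'a \<Rightarrow> bool" where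
  "gap_pair V A u v \<longleftrightarrow> u \<in> V \<inter> A \<and> v \<in> V \<inter> A \<and> u < v \<and> A \<inter> V \<inter> {u<..<v} = {} \<and>
     V \<inter> {u<..<v} \<noteq> {} \<and> \<not> V \<subseteq> {u..v}"

text \<open>The last point \<open>b'\<close> may also lie in \<open>A\<close>: nothing about this is
  known where the pattern is applied in \<open>gap_pair_unblocked\<close>.\<close>

definition alternating :: "'a::linorder set \<Rightarrow> 'a set \<Rightarrow> 'a set \<Rightarrow> bool" where
  "alternating V A B \<longleftrightarrow> (\<exists>a b a' b'. {a, b, a', b'} \<subseteq> V \<and> a < b \<and> b < a' \<and> a' < b' \<and>
     a \<in> A - B \<and> b \<in> B - A \<and> a' \<in> A - B \<and> b' \<in> B)"

text \<open>The relation is the closed polygon on \<open>V\<close>; its second alternative is the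
  edge between the least and the greatest vertex. Without gap pairs it joins neighbours within
  \<open>A\<close>, so walking through \<open>A \<inter> V\<close> in order connects it.\<close>

lemma polygon_support:
  fixes V :: "'a::linorder set"
  assumes "finite V" and no_gap: "\<And>u v. \<not> gap_pair V A u v"
  shows "induces_connected
    (\<lambda>u v. u \<in> V \<and> v \<in> V \<and> u \<noteq> v \<and> (V \<inter> {min u v<..<max u v} = {} \<or> V \<subseteq> {min u v..max u v}))
    (A \<inter> V)" (is "induces_connected ?E _")
proof -
  let ?R = "\<lambda>u v. ?E u v \<and> u \<in> A \<inter> V \<and> v \<in> A \<inter> V"
  have up: "?R\<^sup>*\<^sup>* x y" if "x \<in> A \<inter> V" "y \<in> A \<inter> V" "x \<le> y" for x y
  proof -
    have "finite (A \<inter> V \<inter> {x..y})"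
      using \<open>finite V\<close> by auto
    then show ?thesis
      using that
    proof (induction "A \<inter> V \<inter> {x..y}" arbitrary: y rule: finite_psubset_induct)
      case psubset
      show ?case
      proof (cases "x = y")
        case False
        \<comment> \<open>\<open>q\<close> is the predecessor of \<open>y\<close> within
          \<open>A\<close>; the induction hypothesis covers the walk from \<open>x\<close> to
          \<open>q\<close>.\<close>
        define q where "q = Max (A \<inter> V \<inter> {..<y})"
        have fin: "finite (A \<inter> V \<inter> {..<y})"
          using \<open>finite V\<close> by auto
        have x: "x \<in> A \<inter> V \<inter> {..<y}"
          using psubset.prems False by auto
        have q: "q \<in> A \<inter> V" "q < y"
          using Max_in[OF fin] x by (auto simp: q_def)
        have "x \<le> q"
          unfolding q_def using fin x by (rule Max_ge)
        have "z \<le> q" if "z \<in> A \<inter> V" "z < y" for z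
          unfolding q_def using fin that by (intro Max_ge) auto
        then have "A \<inter> V \<inter> {q<..<y} = {}"
          by fastforce
        then have "V \<inter> {q<..<y} = {} \<or> V \<subseteq> {q..y}"
          using no_gap[of q y] q psubset.prems(2) by (auto simp: gap_pair_def)
        then have "?R q y"
          using q psubset.prems(2) by (auto simp: min_def max_def)
        moreover have "?R\<^sup>*\<^sup>* x q"
        proof (rule psubset.hyps(2))
          show "A \<inter> V \<inter> {x..q} \<subset> A \<inter> V \<inter> {x..y}"
          proof (rule psubsetI)
            show "A \<inter> V \<inter> {x..q} \<subseteq> A \<inter> V \<inter> {x..y}"
              using q by auto
            have "y \<in> A \<inter> V \<inter> {x..y}" "y \<notin> {x..q}"
              using q psubset.prems by auto
            then show "A \<inter> V \<inter> {x..q} \<noteq> A \<inter> V \<inter> {x..y}"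
              by blast
          qed
        qed (use q psubset.prems \<open>x \<le> q\<close> in auto)
        ultimately show ?thesis
          by (rule rtranclp.rtrancl_into_rtrancl[rotated])
      qed simp
    qed
  qed
  have "symp ?R"
    by (auto simp: symp_def min.commute max.commute)
  then have "symp ?R\<^sup>*\<^sup>*"
    by (rule symp_rtranclp)
  show ?thesis
    unfolding induces_connected_def
  proof (intro ballI)
    fix x y assume xy: "x \<in> A \<inter> V" "y \<in> A \<inter> V"
    show "?R\<^sup>*\<^sup>* x y"
    proof (cases "x \<le> y")
      case False
      then have "?R\<^sup>*\<^sup>* y x"
        using up[OF xy(2,1)] by simp
      then show ?thesis
        by (rule sympD[OF \<open>symp ?R\<^sup>*\<^sup>*\<close>])
    qed (rule up[OF xy])
  qed
qed

text \<open>Suppose \<open>B\<close> has a point inside the chord. A further point beyond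
  \<open>v\<close> would complete an alternation; one below \<open>u\<close> would yield a gap pair
  of \<open>B\<close> that straddles \<open>u\<close> and ends before \<open>v\<close>, against the
  minimality of \<open>v\<close>.\<close>

lemma gap_pair_unblocked:
  fixes V :: "'a::linorder set"
  assumes "finite V" "A \<in> \<A>" "B \<in> \<A>" and gap: "gap_pair V A u v"
    and least: "\<And>A' u' v'. A' \<in> \<A> \<Longrightarrow> gap_pair V A' u' v' \<Longrightarrow> v \<le> v'"
    and free: "\<not> alternating V A B"
    and B: "u \<notin> B" "v \<notin> B"
  shows "B \<inter> V \<subseteq> {u<..<v} \<or> B \<inter> V \<inter> {u..v} = {}"
proof (rule ccontr)
  assume "\<not> ?thesis"
  then obtain x y where x: "x \<in> B \<inter> V" "u < x" "x < v" and y: "y \<in> B \<inter> V" "y < u \<or> v < y"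
    using B by (smt (verit) IntE atLeastAtMost_iff disjoint_iff greaterThanLessThan_iff
        linorder_less_linear order_le_less subsetI)
  have u: "u \<in> V" "u \<in> A" and v: "v \<in> V" "v \<in> A"
    using gap by (auto simp: gap_pair_def)
  have "x \<notin> A"
    using gap x by (auto simp: gap_pair_def)
  then have "\<not> v < y"
    using free x y u v B unfolding alternating_def by blast
  then have "y < u"
    using y by simp
  \<comment> \<open>\<open>p\<close> and \<open>q\<close> are the neighbours of \<open>u\<close>
    within \<open>B\<close>. They form a gap pair because \<open>u\<close> lies between them and
    \<open>v\<close> beyond them.\<close>
  define p where "p = Max (B \<inter> V \<inter> {..<u})"
  define q where "q = Min (B \<inter> V \<inter> {u<..})"
  have fin: "finite (B \<inter> V \<inter> {..<u})" "finite (B \<inter> V \<inter> {u<..})"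
    using \<open>finite V\<close> by auto
  have p: "p \<in> B \<inter> V" "p < u"
    using Max_in[OF fin(1)] y \<open>y < u\<close> by (auto simp: p_def)
  have q: "q \<in> B \<inter> V" "u < q"
    using Min_in[OF fin(2)] x by (auto simp: q_def)
  have "q \<le> x"
    unfolding q_def using fin(2) x by (intro Min_le) auto
  then have "q < v"
    using x by simp
  have "z \<le> p \<or> q \<le> z" if "z \<in> B \<inter> V" for z
  proof (cases "z < u")
    case True
    then show ?thesis
      unfolding p_def using fin(1) that by (intro disjI1 Max_ge) auto
  next
    case False
    then have "u < z"
      using that B by (metis IntE linorder_neqE)
    then show ?thesis
      unfolding q_def using fin(2) that by (intro disjI2 Min_le) auto
  qed
  then have "B \<inter> V \<inter> {p<..<q} = {}"
    by fastforce
  moreover have "u \<in> V \<inter> {p<..<q}" "v \<in> V" "v \<notin> {p..q}"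
    using p q u v \<open>q < v\<close> by auto
  ultimately have "gap_pair V B p q"
    using p q unfolding gap_pair_def by fastforce
  then show False
    using least[OF \<open>B \<in> \<A>\<close>] \<open>q < v\<close> by force
qed

lemma noncrossing_support:
  fixes V :: "'a::linorder set"
  assumes "finite V" and "\<And>A B. A \<in> \<A> \<Longrightarrow> B \<in> \<A> \<Longrightarrow> \<not> alternating V A B"
  shows "\<exists>E. simple_graph V E \<and> noncrossing E \<and> (\<forall>A\<in>\<A>. induces_connected E (A \<inter> V))"
  using assms
proof (induction V rule: finite_psubset_induct)
  case (psubset V)
  show ?case
  proof (cases "\<exists>A\<in>\<A>. \<exists>u v. gap_pair V A u v")
    case False
    let ?E = "\<lambda>u v. u \<in> V \<and> v \<in> V \<and> u \<noteq> v \<and>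
      (V \<inter> {min u v<..<max u v} = {} \<or> V \<subseteq> {min u v..max u v})"
    have "simple_graph V ?E"
      by (auto simp: simple_graph_def min.commute max.commute)
    moreover have "noncrossing ?E"
      unfolding noncrossing_def
    proof (intro allI impI notI)
      fix a b c d assume E: "?E a b \<and> ?E c d" and less: "a < c \<and> c < b \<and> b < d"
      then have "min a b = a" "max a b = b"
        by auto
      then have "V \<inter> {a<..<b} = {} \<or> V \<subseteq> {a..b}"
        using E by simp
      moreover have "c \<in> V \<inter> {a<..<b}" "d \<in> V" "d \<notin> {a..b}"
        using E less by auto
      ultimately show False
        by blast
    qed
    moreover have "\<forall>A\<in>\<A>. induces_connected ?E (A \<inter> V)"
      using polygon_support[OF \<open>finite V\<close>] False by blast
    ultimately show ?thesis
      by (intro exI[of _ ?E]) blast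
  next
    case True
    let ?R = "{v. \<exists>A\<in>\<A>. \<exists>u. gap_pair V A u v}"
    have "finite ?R"
      by (rule finite_subset[OF _ \<open>finite V\<close>]) (auto simp: gap_pair_def)
    moreover have "?R \<noteq> {}"
      using True by auto
    ultimately obtain v where "v \<in> ?R" and least: "\<And>v'. v' \<in> ?R \<Longrightarrow> v \<le> v'"
      by (meson Min_in Min_le)
    then obtain A u where A: "A \<in> \<A>" "gap_pair V A u v"
      by auto
    have uv: "u \<in> V" "v \<in> V" "u < v"
      using A by (auto simp: gap_pair_def)
    \<comment> \<open>The two sides of the chord share exactly \<open>u\<close> and
      \<open>v\<close>; a hyperedge containing one of these is glued there.\<close>
    define V1 where "V1 = V \<inter> {u..v}"
    define V2 where "V2 = V - {u<..<v}"
    have V: "V = V1 \<union> V2" "u \<in> V1 \<inter> V2" "v \<in> V1 \<inter> V2"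
      using uv by (auto simp: V1_def V2_def)
    have sub: "V1 \<subset> V" "V2 \<subset> V"
      using A by (auto simp: gap_pair_def V1_def V2_def)
    have "\<not> alternating W B C" if "W \<subseteq> V" "B \<in> \<A>" "C \<in> \<A>" for W B C
      using psubset.prems[OF that(2,3)] that(1) unfolding alternating_def by (meson subset_trans)
    then obtain E1 E2
      where E1: "simple_graph V1 E1" "noncrossing E1" "\<And>B. B \<in> \<A> \<Longrightarrow> induces_connected E1 (B \<inter> V1)"
        and E2: "simple_graph V2 E2" "noncrossing E2" "\<And>B. B \<in> \<A> \<Longrightarrow> induces_connected E2 (B \<inter> V2)"
      using psubset.IH[OF sub(1)] psubset.IH[OF sub(2)] sub by (metis psubset_imp_subset)
    let ?E = "\<lambda>x y. E1 x y \<or> E2 x y"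
    have in1: "x \<in> V" "u \<le> x" "x \<le> v" "y \<in> V" "u \<le> y" "y \<le> v" if "E1 x y" for x y
      using E1(1) that by (auto simp: simple_graph_def V1_def)
    have in2: "x \<in> V" "x \<le> u \<or> v \<le> x" "y \<in> V" "y \<le> u \<or> v \<le> y" if "E2 x y" for x y
      using E2(1) that by (auto simp: simple_graph_def V2_def not_less)
    have "simple_graph V ?E"
      using E1(1) E2(1) sub unfolding simple_graph_def by blast
    moreover have "noncrossing ?E"
      unfolding noncrossing_def
    proof (intro allI impI)
      fix a b c d assume "?E a b \<and> ?E c d"
      then consider "E1 a b" "E1 c d" | "E2 a b" "E2 c d" | "E1 a b" "E2 c d" | "E2 a b" "E1 c d"
        by blast
      then show "\<not> (a < c \<and> c < b \<and> b < d)"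
      proof cases
        \<comment> \<open>Edges of \<open>E1\<close> stay within \<open>{u..v}\<close> and edges of
          \<open>E2\<close> have no end strictly inside; a mixed crossing would put an end of the
          \<open>E2\<close> edge strictly between \<open>u\<close> and \<open>v\<close>.\<close>
        case 3
        then show ?thesis
          using in1[OF 3(1)] in2[OF 3(2)] by auto
      next
        case 4
        then show ?thesis
          using in2[OF 4(1)] in1[OF 4(2)] by auto
      qed (use E1(2) E2(2) in \<open>auto simp: noncrossing_def\<close>)
    qed
    moreover have "induces_connected ?E (B \<inter> V)" if "B \<in> \<A>" for B
    proof (cases "u \<in> B \<or> v \<in> B")
      case True
      then obtain c where "c \<in> B \<inter> V1" "c \<in> B \<inter> V2"
        using V by auto
      from induces_connected_Un[OF E1(3)[OF that] E2(3)[OF that] this] show ?thesis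
        using V(1) by (simp add: Int_Un_distrib)
    next
      case False
      have "B \<inter> V \<subseteq> {u<..<v} \<or> B \<inter> V \<inter> {u..v} = {}"
        using gap_pair_unblocked[OF \<open>finite V\<close> A(1) that A(2)] least psubset.prems[OF A(1) that] False
        by blast
      then have "B \<inter> V = B \<inter> V1 \<or> B \<inter> V = B \<inter> V2"
      proof
        assume "B \<inter> V \<subseteq> {u<..<v}"
        then have "B \<inter> V = B \<inter> V1"
          by (fastforce simp: V1_def)
        then show ?thesis ..
      next
        assume "B \<inter> V \<inter> {u..v} = {}"
        then have "B \<inter> V = B \<inter> V2"
          by (fastforce simp: V2_def)
        then show ?thesis ..
      qed
      then show ?thesis
        using induces_connected_mono[OF E1(3)[OF that], of ?E]
          induces_connected_mono[OF E2(3)[OF that], of ?E] by auto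
    qed
    ultimately show ?thesis
      by (intro exI[of _ ?E]) blast
  qed
qed

section \<open>Ordering the family\<close>

text \<open>For the empty set the minimum is a junk value; injectivity on subsets of \<open>{..<n}\<close> holds
  nevertheless because the rank modulo \<open>2 ^ n\<close> already determines the set.\<close>

definition family_rank :: "nat \<Rightarrow> nat set \<Rightarrow> int" where
  "family_rank n H = int (Min H) * 2 ^ n - int (set_encode H)"

lemma set_encode_lessThan: "set_encode {..<n} = 2 ^ n - 1"
  using sum_power2[of n] by (simp add: set_encode_def lessThan_atLeast0)

lemma set_encode_less_power:
  assumes "H \<subseteq> {..<n}"
  shows "set_encode H < 2 ^ n"
proof -
  have "set_encode H \<le> set_encode {..<n}"
    using assms unfolding set_encode_def by (intro sum_mono2) auto
  then show ?thesis
    using zero_less_power[of "2::nat" n] unfolding set_encode_lessThan by linarith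
qed

text \<open>The largest element of the symmetric difference decides a comparison of binary codes,
  because elements below \<open>a\<close> weigh less than \<open>2 ^ a\<close> in total. This serves
  as the tie-break between sets with equal minimum.\<close>

lemma set_encode_lessD:
  assumes "finite A" "finite B" "set_encode A < set_encode B" "a \<in> A - B"
  shows "\<exists>b\<in>B - A. a < b"
proof (rule ccontr)
  assume "\<not> ?thesis"
  then have "B - A \<subseteq> {..<a}"
    using assms(4) by (auto simp: not_less order_le_less)
  then have "set_encode (B - A) < 2 ^ a"
    by (rule set_encode_less_power)
  also have "2 ^ a \<le> set_encode (A - B)"
    using assms unfolding set_encode_def by (intro member_le_sum) auto
  finally have "set_encode (B - A) + set_encode (A \<inter> B) < set_encode (A - B) + set_encode (A \<inter> B)"
    by simp
  moreover have "set_encode A = set_encode (A - B) + set_encode (A \<inter> B)"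
    using assms(1) unfolding set_encode_def by (metis add.commute sum.Int_Diff)
  moreover have "set_encode B = set_encode (B - A) + set_encode (A \<inter> B)"
    using assms(2) unfolding set_encode_def by (metis add.commute Int_commute sum.Int_Diff)
  ultimately show False
    using assms(3) by simp
qed

lemma inj_on_family_rank: "inj_on (family_rank n) (Pow {..<n})"
proof (rule inj_onI)
  fix A B assume A: "A \<in> Pow {..<n}" and B: "B \<in> Pow {..<n}"
    and eq: "family_rank n A = family_rank n B"
  \<comment> \<open>Reducing modulo \<open>2 ^ n\<close> removes the minimum and leaves the binary
    code, which is less than \<open>2 ^ n\<close>.\<close>
  have "int (set_encode X) = (- family_rank n X) mod 2 ^ n" if "X \<in> Pow {..<n}" for X
  proof -
    have "int (set_encode X) < 2 ^ n"
      using set_encode_less_power[of X n] that by (simp add: of_nat_less_numeral_power_cancel_iff)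
    then have "int (set_encode X) = int (set_encode X) mod 2 ^ n"
      by simp
    also have "\<dots> = (int (set_encode X) + (- int (Min X)) * 2 ^ n) mod 2 ^ n"
      by (rule mod_mult_self1[symmetric])
    also have "int (set_encode X) + (- int (Min X)) * 2 ^ n = - family_rank n X"
      by (simp add: family_rank_def)
    finally show ?thesis .
  qed
  from this[OF A] this[OF B] have "set_encode A = set_encode B"
    using eq by simp
  moreover have "finite A" "finite B"
    using A B finite_subset by auto
  ultimately show "A = B"
    by (simp add: set_encode_eq)
qed

text \<open>Binary codes stay below \<open>2 ^ n\<close>, so a difference of one in the minimum
  outweighs them.\<close>

lemma family_rank_less_MinD:
  assumes "family_rank n A < family_rank n B" "A \<subseteq> {..<n}" "B \<subseteq> {..<n}"
  shows "Min A \<le> Min B"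
proof (rule ccontr)
  assume "\<not> ?thesis"
  then have "(int (Min B) + 1) * 2 ^ n \<le> int (Min A) * 2 ^ n"
    by (intro mult_right_mono) auto
  moreover have "int (set_encode A) < 2 ^ n"
    using set_encode_less_power[OF assms(2)] by (metis of_nat_less_iff of_nat_numeral of_nat_power)
  moreover have "0 \<le> int (set_encode B)"
    by simp
  ultimately show False
    using assms(1) unfolding family_rank_def by (simp only: distrib_right)
qed

section \<open>Forbidden alternations after cutting the cycle open at 0\<close>

lemma axax_free_no_alternation:
  assumes "axax_free n F" "A \<in> F" "B \<in> F" "A \<subseteq> {..<n}" "B \<subseteq> {..<n}"
    "a \<in> A - B" "a' \<in> A - B" "x \<in> B" "x' \<in> B"
  shows "\<not> (a < x \<and> x < a' \<and> a' < x')" "\<not> (x < a \<and> a < x' \<and> x' < a')"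
proof -
  have "a < n" "a' < n" "x < n" "x' < n"
    using assms by auto
  \<comment> \<open>The second quadruple exchanges \<open>x\<close> and \<open>x'\<close>; read from
    its last vertex it is the second linear pattern.\<close>
  moreover have "\<not> cyc_order n a x a' x'" "\<not> cyc_order n a x' a' x"
    using assms(1-3,6-9) unfolding axax_free_def axax_pair_def by blast+
  ultimately show "\<not> (a < x \<and> x < a' \<and> a' < x')" "\<not> (x < a \<and> a < x' \<and> x' < a')"
    by (auto simp: cyc_order_def)
qed

lemma intersection_property_no_alternation:
  assumes "intersection_property n F G" "H \<in> F" "K \<in> G" "H \<subseteq> {..<n}" "K \<subseteq> {..<n}" "H \<inter> K = {}"
    "h \<in> H" "h' \<in> H" "k \<in> K" "k' \<in> K"
  shows "\<not> (h < k \<and> k < h' \<and> h' < k')" "\<not> (k < h \<and> h < k' \<and> k' < h')"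
proof -
  have "h < n" "h' < n" "k < n" "k' < n"
    using assms by auto
  moreover have "\<not> cyc_order n h k h' k'" "\<not> cyc_order n h k' h' k"
    using assms(1-3,6-10) unfolding intersection_property_def by blast+
  ultimately show "\<not> (h < k \<and> k < h' \<and> h' < k')" "\<not> (k < h \<and> h < k' \<and> k' < h')"
    by (auto simp: cyc_order_def)
qed

text \<open>Otherwise \<open>Min B < a < b\<close>, and one more point of \<open>A - B\<close> makes
  an axax-pair: for equal minima the tie-break supplies one above \<open>b\<close>, and for
  \<open>Min A < Min B\<close> the point \<open>Min A\<close> itself serves.\<close>

lemma family_rank_less_differences:
  assumes free: "axax_free n F" and AB: "A \<in> F" "B \<in> F" "A \<subseteq> {..<n}" "B \<subseteq> {..<n}"
    and less: "family_rank n A < family_rank n B"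
    and a: "a \<in> A - B" and b: "b \<in> B - A"
  shows "b < a \<or> a < Min B"
proof (rule ccontr)
  assume "\<not> ?thesis"
  then have "a < b" "Min B \<le> a"
    using a b by (auto simp: not_less order_le_less)
  have fin: "finite A" "finite B"
    using AB finite_subset by auto
  have minA: "Min A \<in> A" and minB: "Min B \<in> B"
    using fin a b by (auto intro: Min_in)
  have "Min B < a"
    using \<open>Min B \<le> a\<close> minB a by (auto simp: order_le_less)
  consider "Min A = Min B" | "Min A < Min B"
    using family_rank_less_MinD[OF less AB(3,4)] by linarith
  then show False
  proof cases
    case 1
    then have "set_encode B < set_encode A"
      using less by (simp add: family_rank_def)
    then obtain a' where "a' \<in> A - B" "b < a'"
      using set_encode_lessD[OF fin(2,1) _ b] by blast
    then show False
      using axax_free_no_alternation(2)[OF free AB a, of a' "Min B" b] minB b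
        \<open>Min B < a\<close> \<open>a < b\<close> by auto
  next
    case 2
    then have "Min A \<in> A - B"
      using minA fin by (auto simp: not_le dest: Min_le)
    then show False
      using axax_free_no_alternation(1)[OF free AB _ a, of "Min A" "Min B" b] minB b
        2 \<open>Min B < a\<close> \<open>a < b\<close> by auto
  qed
qed

text \<open>A chord of the cycle inside \<open>H\<close> never separates two vertices of a \<open>K\<close> that misses \<open>H\<close>, and
  \<open>w\<^sub>1, w\<^sub>3\<close> never separate \<open>z\<^sub>2, z\<^sub>4\<close>. Comparing \<open>H\<^sub>2\<close> with \<open>H\<^sub>3\<close> leaves the two cases below.\<close>

lemma hitting_sets_no_alternation:
  assumes strong: "strong_axax_free n \<H> \<K>"
    and sub: "\<And>H. H \<in> \<H> \<Longrightarrow> H \<subseteq> {..<n}" "\<And>K. K \<in> \<K> \<Longrightarrow> K \<subseteq> {..<n}"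
    and K: "K \<in> \<K>" "L \<in> \<K>" and H: "H1 \<in> \<H>" "H2 \<in> \<H>" "H3 \<in> \<H>" "H4 \<in> \<H>"
    and less: "family_rank n H1 < family_rank n H2" "family_rank n H2 < family_rank n H3"
      "family_rank n H3 < family_rank n H4"
    and H1: "H1 \<inter> K \<noteq> {}" "H1 \<inter> L = {}" and H2: "H2 \<inter> L \<noteq> {}" "H2 \<inter> K = {}"
    and H3: "H3 \<inter> K \<noteq> {}" "H3 \<inter> L = {}" and H4: "H4 \<inter> L \<noteq> {}"
  shows False
proof -
  have free: "axax_free n \<H>" "axax_free n \<K>" and ip: "intersection_property n \<H> \<K>"
    using strong by (auto simp: strong_axax_free_def)
  obtain w1 w3 z2 z4 where w1: "w1 \<in> H1" "w1 \<in> K" and w3: "w3 \<in> H3" "w3 \<in> K"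
    and z2: "z2 \<in> H2" "z2 \<in> L" and z4: "z4 \<in> H4" "z4 \<in> L"
    using H1 H2 H3 H4 by blast
  have notin: "w1 \<notin> H2" "w1 \<notin> L" "w3 \<notin> H2" "w3 \<notin> L" "z2 \<notin> H1" "z2 \<notin> H3" "z4 \<notin> H1" "z4 \<notin> H3"
    using w1 w3 z2 z4 H1 H2 H3 by auto
  have Min: "Min X \<in> X \<and> Min X \<le> x" if "X \<in> \<H>" "x \<in> X" for X x
    using sub(1)[OF that(1)] that(2) finite_subset[of X "{..<n}"] by (auto intro: Min_in)
  have mins: "Min H1 \<le> Min H2" "Min H2 \<le> Min H3" "Min H3 \<le> Min H4"
    using family_rank_less_MinD less H sub(1) by auto
  note m1 = Min[OF H(1) w1(1)] and m2 = Min[OF H(2) z2(1)] and m3 = Min[OF H(3) w3(1)]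
    and m4 = Min[OF H(4) z4(1)]
  \<comment> \<open>Comparisons with minima come as \<open>\<le>\<close>; these inequations, each
    between a point of some set and a point outside it, make the bounds strict.\<close>
  have ne: "Min H1 \<noteq> z2" "Min H2 \<noteq> w3" "Min H3 \<noteq> z4" "z4 \<noteq> w1" "z4 \<noteq> w3" "z2 \<noteq> w1" "w1 \<noteq> Min H2"
    using m1 m2 m3 notin w1 w3 z2 z4 by auto
  have "w3 < z2 \<or> z2 < Min H3"
    using family_rank_less_differences[OF free(1) H(2,3) sub(1)[OF H(2)] sub(1)[OF H(3)] less(2)]
      z2 w3 notin by blast
  then show False
  proof
    assume "z2 < Min H3"
    \<comment> \<open>\<open>H3\<close> and \<open>L\<close> are disjoint, so this order is
      impossible; since \<open>z4\<close> is above \<open>Min H3\<close>, it must exceed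
      \<open>w3\<close>.\<close>
    have "\<not> (z2 < Min H3 \<and> Min H3 < z4 \<and> z4 < w3)"
      using intersection_property_no_alternation(2)
          [OF ip H(3) K(2) sub(1)[OF H(3)] sub(2)[OF K(2)] H3(2), of "Min H3" w3 z2 z4]
        m3 w3 z2 z4 by blast
    then have "w3 < z4" "z2 < w3"
      using \<open>z2 < Min H3\<close> mins m3 m4 ne by linarith+
    \<comment> \<open>Freeness of \<open>\<K>\<close> puts \<open>w1\<close> between
      \<open>z2\<close> and \<open>z4\<close>. As \<open>Min H1\<close> precedes \<open>z2\<close>,
      the disjoint sets \<open>H1\<close> and \<open>L\<close> then alternate.\<close>
    moreover have "\<not> (w1 < z2 \<and> z2 < w3 \<and> w3 < z4)" "\<not> (z2 < w3 \<and> w3 < z4 \<and> z4 < w1)"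
      using axax_free_no_alternation[OF free(2) K sub(2)[OF K(1)] sub(2)[OF K(2)], of w1 w3 z2 z4]
        axax_free_no_alternation[OF free(2) K sub(2)[OF K(1)] sub(2)[OF K(2)], of w3 w1 z2 z4]
        w1 w3 z2 z4 notin by blast+
    ultimately have "z2 < w1" "w1 < z4"
      using ne by linarith+
    then show False
      using intersection_property_no_alternation(1)
          [OF ip H(1) K(2) sub(1)[OF H(1)] sub(2)[OF K(2)] H1(2), of "Min H1" w1 z2 z4]
        m1 w1 z2 z4 mins m2 ne by linarith
  next
    assume "w3 < z2"
    \<comment> \<open>\<open>H2\<close> misses \<open>K\<close>, so \<open>w1\<close> lies between
      \<open>Min H2\<close> and \<open>z2\<close> just as \<open>w3\<close> does. This contradicts
      the rank order of \<open>H1\<close> and \<open>H2\<close>, whose differences contain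
      \<open>w1\<close> and \<open>z2\<close>.\<close>
    have "\<not> (w1 < Min H2 \<and> Min H2 < w3 \<and> w3 < z2)" "\<not> (Min H2 < w3 \<and> w3 < z2 \<and> z2 < w1)"
      using intersection_property_no_alternation
          [OF ip H(2) K(1) sub(1)[OF H(2)] sub(2)[OF K(1)] H2(2), of "Min H2" z2 w1 w3]
        intersection_property_no_alternation
          [OF ip H(2) K(1) sub(1)[OF H(2)] sub(2)[OF K(1)] H2(2), of "Min H2" z2 w3 w1]
        m2 w1 w3 z2 by blast+
    then have "Min H2 < w1" "w1 < z2"
      using \<open>w3 < z2\<close> mins m3 ne by linarith+
    then show False
      using family_rank_less_differences[OF free(1) H(1,2) sub(1)[OF H(1)] sub(1)[OF H(2)] less(1), of w1 z2]
        w1 z2 notin by auto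
  qed
qed

text \<open>A path in the image lifts vertex by vertex; injectivity makes the lift end at the
  prescribed vertex.\<close>

lemma induces_connected_inj_preimage:
  assumes "induces_connected E (f ` S)" "inj_on f V" "S \<subseteq> V"
  shows "induces_connected (\<lambda>u v. u \<in> V \<and> v \<in> V \<and> E (f u) (f v)) S"
proof -
  let ?R = "\<lambda>u v. (u \<in> V \<and> v \<in> V \<and> E (f u) (f v)) \<and> u \<in> S \<and> v \<in> S"
  have "\<exists>y'\<in>S. b = f y' \<and> ?R\<^sup>*\<^sup>* x y'"
    if "(\<lambda>u v. E u v \<and> u \<in> f ` S \<and> v \<in> f ` S)\<^sup>*\<^sup>* (f x) b" "x \<in> S" for x b
    using that
  proof (induction rule: rtranclp_induct)
    case (step b c)
    then obtain y' z' where "y' \<in> S" "b = f y'" "?R\<^sup>*\<^sup>* x y'" "z' \<in> S" "c = f z'"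
      by blast
    moreover from this have "?R y' z'"
      using step.hyps(2) assms(3) by auto
    ultimately show ?case
      using rtranclp.rtrancl_into_rtrancl[of ?R x y' z'] by blast
  qed auto
  then show ?thesis
    using assms unfolding induces_connected_def
    by (smt (verit) image_eqI inj_onD subsetD)
qed

theorem mainTheorem14:
  fixes n :: nat and \<H> \<K> :: "nat set set"
  assumes "n \<ge> 3"
    and "\<forall>H\<in>\<H>. H \<subseteq> {0..<n}"
    and "\<forall>K\<in>\<K>. K \<subseteq> {0..<n}"
    and "strong_axax_free n \<H> \<K>"
  shows "\<exists>E :: nat set \<Rightarrow> nat set \<Rightarrow> bool. simple_graph \<H> E \<and> outerplanar \<H> E \<and>
           (\<forall>K\<in>\<K>. induces_connected E {H\<in>\<H>. H \<inter> K \<noteq> {}})"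
proof -
  have sub: "H \<subseteq> {..<n}" if "H \<in> \<H>" for H
    using assms(2) that by (auto simp: lessThan_atLeast0)
  have subK: "K \<subseteq> {..<n}" if "K \<in> \<K>" for K
    using assms(3) that by (auto simp: lessThan_atLeast0)
  let ?f = "family_rank n"
  define hit where "hit K = {H\<in>\<H>. H \<inter> K \<noteq> {}}" for K
  have inj: "inj_on ?f \<H>"
    using inj_on_family_rank by (rule inj_on_subset) (use sub in auto)
  have "finite \<H>"
    by (rule finite_subset[of _ "Pow {..<n}"]) (use sub in auto)
  \<comment> \<open>By injectivity of the rank, passing to images creates no new incidences.\<close>
  have mem: "?f H \<in> ?f ` hit K \<longleftrightarrow> H \<inter> K \<noteq> {}" if "H \<in> \<H>" for H K
    using inj that by (auto simp: hit_def dest: inj_onD)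
  have "\<not> alternating (?f ` \<H>) (?f ` hit K) (?f ` hit L)" if KL: "K \<in> \<K>" "L \<in> \<K>" for K L
  proof
    assume "alternating (?f ` \<H>) (?f ` hit K) (?f ` hit L)"
    then obtain H1 H2 H3 H4 where H: "H1 \<in> \<H>" "H2 \<in> \<H>" "H3 \<in> \<H>" "H4 \<in> \<H>"
      and less: "?f H1 < ?f H2" "?f H2 < ?f H3" "?f H3 < ?f H4"
      and pattern: "?f H1 \<in> ?f ` hit K - ?f ` hit L" "?f H2 \<in> ?f ` hit L - ?f ` hit K"
        "?f H3 \<in> ?f ` hit K - ?f ` hit L" "?f H4 \<in> ?f ` hit L"
      unfolding alternating_def by auto
    show False
      by (rule hitting_sets_no_alternation[OF assms(4) sub subK KL H less])
        (use pattern H in \<open>simp_all add: mem\<close>)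
  qed
  then have "\<exists>E. simple_graph (?f ` \<H>) E \<and> noncrossing E \<and>
      (\<forall>A\<in>(\<lambda>K. ?f ` hit K) ` \<K>. induces_connected E (A \<inter> ?f ` \<H>))"
    using \<open>finite \<H>\<close> by (intro noncrossing_support) auto
  then obtain E where E: "simple_graph (?f ` \<H>) E" "noncrossing E"
    "\<And>K. K \<in> \<K> \<Longrightarrow> induces_connected E (?f ` hit K \<inter> ?f ` \<H>)"
    by auto
  \<comment> \<open>The support lives on the integer ranks; it is pulled back to the sets along the
    injective rank.\<close>
  let ?Q = "\<lambda>u v. u \<in> \<H> \<and> v \<in> \<H> \<and> E (?f u) (?f v)"
  have graph: "simple_graph \<H> ?Q"
    using E(1) unfolding simple_graph_def by blast
  moreover have "outerplanar \<H> ?Q"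
  proof (rule outerplanar_if_noncrossing[OF graph])
    show "inj_on (\<lambda>H. real_of_int (?f H)) \<H>"
      using inj by (auto simp: inj_on_def)
  qed (use E(2) in \<open>auto simp: noncrossing_def\<close>)
  moreover have "induces_connected ?Q (hit K)" if "K \<in> \<K>" for K
  proof (rule induces_connected_inj_preimage[OF _ inj])
    have "?f ` hit K \<inter> ?f ` \<H> = ?f ` hit K"
      by (auto simp: hit_def)
    then show "induces_connected E (?f ` hit K)"
      using E(3)[OF that] by simp
  qed (auto simp: hit_def)
  ultimately show ?thesis
    unfolding hit_def by (intro exI[of _ ?Q]) blast
qed

end
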